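(* Let $p$ be an odd prime and $a\in\mathbb{Z}_p$ with $\langle a\rangle_p\equiv 1\pmod 2$. Then $$\sum_{k=0}^{p-1}\binom ak\binom{-1-a}k\frac 1{2^k}\equiv 0\pmod{p^2}.$$
   Context: $\mathbb{Z}_p$ denotes the set of rational $p$-integers, i.e. rational numbers whose denominator is not divisible by $p$; congruences are in $\mathbb{Z}_p$. For $a\in\mathbb{Z}_p$, $\langle a\rangle_p\in\{0,1,\ldots,p-1\}$ is the least nonnegative residue of $a$ modulo $p$. $\binom ak=a(a-1)\cdots(a-k+1)/k!$ (with $\binom a0=1$). *)

theory Defs
  imports "HOL-Number_Theory.Number_Theory"
begin

text \<open>The ring of rational \<open>p\<close>-integers; \<open>quotient_of\<close> returns the fraction in lowest terms.\<close>

definition pints :: "nat \<Rightarrow> rat set"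
  where "pints p = {x. \<not> int p dvd snd (quotient_of x)}"

text \<open>
  Congruence in the ring of \<open>p\<close>-integers. The library's \<^const>\<open>cong\<close> is of no use on
  \<^typ>\<open>rat\<close>, where every nonzero modulus is a unit.
\<close>

definition pcong :: "nat \<Rightarrow> rat \<Rightarrow> rat \<Rightarrow> nat \<Rightarrow> bool"
  where "pcong p x y m \<longleftrightarrow>
    x \<in> pints p \<and> y \<in> pints p \<and> (\<exists>z\<in>pints p. x - y = of_nat m * z)"

definition least_residue :: "nat \<Rightarrow> rat \<Rightarrow> nat"
  where "least_residue p a = (LEAST r::nat. pcong p a (of_nat r) p)"

lemma mem_pints_iff:
  assumes "prime p"
  shows "x \<in> pints p \<longleftrightarrow> (\<exists>u v::int. \<not> int p dvd v \<and> x = of_int u / of_int v)"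
proof
  assume x: "x \<in> pints p"
  obtain u v where uv: "quotient_of x = (u, v)" by fastforce
  show "\<exists>u v::int. \<not> int p dvd v \<and> x = of_int u / of_int v"
    using x uv quotient_of_div[OF uv] unfolding pints_def by auto
next
  assume "\<exists>u v::int. \<not> int p dvd v \<and> x = of_int u / of_int v"
  then obtain u v :: int where v: "\<not> int p dvd v" and x: "x = of_int u / of_int v" by blast
  obtain n d where nd: "quotient_of x = (n, d)" by fastforce
  have d: "d > 0" and cop: "coprime n d" and xnd: "x = of_int n / of_int d"
    using quotient_of_denom_pos[OF nd] quotient_of_coprime[OF nd] quotient_of_div[OF nd] by auto
  have "v \<noteq> 0" using v by auto
  then have "(of_int (u * d) :: rat) = of_int (n * v)"
    using x xnd d by (simp add: field_simps)
  then have "u * d = n * v" by (simp only: of_int_eq_iff)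
  then have "d dvd n * v" by (metis dvd_triv_right)
  then have "d dvd v" using cop by (simp add: coprime_commute coprime_dvd_mult_right_iff)
  then show "x \<in> pints p" using v nd unfolding pints_def by (auto dest: dvd_trans)
qed

lemma ex_residue:
  assumes p: "prime p" and a: "a \<in> pints p"
  shows "\<exists>r<p. pcong p a (of_nat r) p"
proof -
  obtain u v :: int where v: "\<not> int p dvd v" and auv: "a = of_int u / of_int v"
    using a mem_pints_iff[OF p] by blast
  have p': "prime (int p)" using p by simp
  have "coprime v (int p)"
    using prime_imp_coprime[OF p' v] by (simp add: coprime_commute)
  then obtain w where w: "[v * w = 1] (mod int p)" by (meson cong_solve_coprime_int)
  define r where "r = nat ((u * w) mod int p)"
  have ppos: "int p > 0" using p by (simp add: prime_gt_0_nat)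
  have rp: "r < p" unfolding r_def using ppos by (simp add: nat_less_iff)
  have ri: "int r = (u * w) mod int p" unfolding r_def using ppos by simp
  have "[v * int r = v * (u * w)] (mod int p)"
    unfolding ri by (intro cong_mult cong_refl) (simp add: cong_def)
  also have "v * (u * w) = u * (v * w)" by (simp add: ac_simps)
  also have "[u * (v * w) = u * 1] (mod int p)" using w by (intro cong_mult cong_refl)
  finally have "[u = v * int r] (mod int p)" by (simp add: cong_sym)
  then have "int p dvd u - v * int r" by (simp add: cong_iff_dvd_diff)
  then obtain t where t: "u - v * int r = int p * t" by (auto elim: dvdE)
  have v0: "v \<noteq> 0" using v by auto
  have "(of_int u :: rat) - of_int v * of_nat r = of_nat p * of_int t"
    using arg_cong[OF t, of "of_int :: int \<Rightarrow> rat"] by simp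
  then have "a - of_nat r = of_nat p * (of_int t / of_int v)"
    using v0 auv by (simp add: field_simps)
  moreover have "(of_int t / of_int v :: rat) \<in> pints p"
    using v mem_pints_iff[OF p] by blast
  moreover have "(of_nat r :: rat) \<in> pints p"
    unfolding mem_pints_iff[OF p] using p not_prime_1
    by (intro exI[of _ "int r"] exI[of _ 1]) auto
  ultimately show ?thesis using a rp unfolding pcong_def by blast
qed

lemma least_residue:
  assumes "prime p" "a \<in> pints p"
  shows "least_residue p a < p" "pcong p a (of_nat (least_residue p a)) p"
proof -
  obtain r where r: "r < p" "pcong p a (of_nat r) p" using ex_residue[OF assms] by blast
  show "pcong p a (of_nat (least_residue p a)) p"
    unfolding least_residue_def by (rule LeastI[of _ r]) (rule r)
  have "least_residue p a \<le> r"
    unfolding least_residue_def by (rule Least_le) (rule r)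
  then show "least_residue p a < p" using r by simp
qed

end

theory Submission
  imports Defs
begin

text \<open>
  Write \<open>S(a)\<close> for the sum. Without truncation it is the Legendre function \<open>P\<^sub>a(x)\<close> at \<open>x = 0\<close>,
  because \<open>(-1 - a) gchoose k = (-1)^k * ((a + k) gchoose k)\<close>. The three-term recurrence of the
  Legendre functions, which at \<open>x = 0\<close> couples only the degrees \<open>b + 1\<close> and \<open>b - 1\<close>, explains why
  odd degrees give zero. Truncation after the summand \<open>T\<close> of \<open>S(b)\<close> costs a single boundary term:
  \<open>(b + 1) * S(b + 1) + b * S(b - 1) = (2 * b + 1) * T\<close> (lemma \<open>legendre_sum_recurrence\<close>).

  Here \<open>T\<close> is the summand with index \<open>p - 1\<close>. If \<open>b\<close> is congruent to neither \<open>0\<close> nor \<open>-1\<close> modulo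
  \<open>p\<close>, then each of the two binomial coefficients in \<open>T\<close> is divisible by \<open>p\<close>, so \<open>T\<close> vanishes
  modulo \<open>p\<^sup>2\<close>. Hence \<open>a * S(a) \<equiv> -(a - 1) * S(a - 2)\<close> with a unit \<open>a\<close> whenever the residue of \<open>a\<close>
  is odd and at least \<open>3\<close>, and descent in steps of two reduces the claim to residue \<open>1\<close>.

  For \<open>a = b + 1\<close> with \<open>b\<close> divisible by \<open>p\<close> the boundary term does not vanish, but it cancels:
  modulo \<open>p\<close> only the summand \<open>k = 0\<close> of \<open>S(b - 1)\<close> survives, so \<open>b * S(b - 1) \<equiv> b\<close>, while
  \<open>T \<equiv> b\<close>, both modulo \<open>p\<^sup>2\<close>; so \<open>a * S(a) \<equiv> (2 * b + 1) * b - b = 2 * b\<^sup>2 \<equiv> 0\<close>.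
\<close>

section \<open>The truncated Legendre sum at zero\<close>

definition legendre_term :: "rat \<Rightarrow> nat \<Rightarrow> rat"
  where "legendre_term a k = (a gchoose k) * ((-1 - a) gchoose k) * (1 / 2 ^ k)"

definition legendre_sum :: "rat \<Rightarrow> nat \<Rightarrow> rat"
  where "legendre_sum a n = (\<Sum>k=0..n. legendre_term a k)"

lemma gbinomial_Suc_shift_up:
  "of_nat (Suc m) * ((b + 1 :: rat) gchoose Suc m) = (b + 1) * (b gchoose m)"
  using gbinomial_absorption[of m "b + 1"] by simp

lemma gbinomial_Suc_same:
  "of_nat (Suc m) * ((b :: rat) gchoose Suc m) = (b - of_nat m) * (b gchoose m)"
  using gbinomial_mult_1[of b m] by (simp add: algebra_simps)

text \<open>The factor \<open>b\<close> makes the identity hold at \<open>b = 0\<close> too; the recurrence supplies exactly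
  this factor, so it needs no case distinction.\<close>

lemma gbinomial_Suc_shift_down:
  "of_nat (Suc m) * (b * ((b - 1 :: rat) gchoose Suc m))
     = (b - 1 - of_nat m) * (b - of_nat m) * (b gchoose m)"
proof -
  have "of_nat (Suc m) * (b * ((b - 1) gchoose Suc m))
      = b * (of_nat (Suc m) * ((b - 1) gchoose Suc m))"
    by (simp only: mult.left_commute)
  also have "\<dots> = (b - 1 - of_nat m) * (b * ((b - 1) gchoose m))"
    unfolding gbinomial_Suc_same by (simp only: mult.left_commute)
  also have "b * ((b - 1) gchoose m) = (b - of_nat m) * (b gchoose m)"
    using gbinomial_absorb_comp[of b m] by simp
  finally show ?thesis by (simp only: mult.assoc)
qed

text \<open>The telescoping certificate of the recurrence. Multiplied by \<open>(Suc m)\<^sup>2\<close>, every term is a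
  multiple of \<open>(b gchoose m) * ((-1 - b) gchoose m)\<close>, where the shift down in one upper index uses
  the factor \<open>b + 1\<close> or \<open>b\<close> in front of its term. What remains is a polynomial identity in \<open>b\<close>
  and \<open>m\<close>.\<close>

lemma legendre_term_telescope:
  "(b + 1) * legendre_term (b + 1) (Suc m) + b * legendre_term (b - 1) (Suc m)
     = (2 * b + 1) * (legendre_term b (Suc m) - legendre_term b m)"
proof -
  define n :: rat where "n = of_nat (Suc m)"
  define w :: rat where "w = 1 / 2 ^ Suc m"
  define c where "c = -1 - b"
  define A where "A = b gchoose m"
  define B where "B = c gchoose m"
  have n0: "n \<noteq> 0" unfolding n_def by (simp del: of_nat_Suc)
  have m: "of_nat m = n - 1" unfolding n_def by simp
  have args: "-1 - (b + 1) = c - 1" "-1 - (b - 1) = c + 1" unfolding c_def by simp_all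
  have w2: "1 / 2 ^ m = 2 * w" unfolding w_def by simp
  have up: "n * ((b + 1) gchoose Suc m) = (b + 1) * A" "n * ((c + 1) gchoose Suc m) = (c + 1) * B"
    unfolding n_def A_def B_def by (rule gbinomial_Suc_shift_up)+
  have same: "n * (b gchoose Suc m) = (b - (n - 1)) * A" "n * (c gchoose Suc m) = (c - (n - 1)) * B"
    unfolding A_def B_def m[symmetric] unfolding n_def by (rule gbinomial_Suc_same)+
  have down: "n * (b * ((b - 1) gchoose Suc m)) = (b - 1 - (n - 1)) * (b - (n - 1)) * A"
    "n * (c * ((c - 1) gchoose Suc m)) = (c - 1 - (n - 1)) * (c - (n - 1)) * B"
    unfolding A_def B_def m[symmetric] unfolding n_def by (rule gbinomial_Suc_shift_down)+
  have b1: "b + 1 = - c" unfolding c_def by simp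
  have "n\<^sup>2 * ((b + 1) * legendre_term (b + 1) (Suc m))
      = - ((n * ((b + 1) gchoose Suc m)) * (n * (c * ((c - 1) gchoose Suc m))) * w)"
    unfolding legendre_term_def args w_def[symmetric] b1 by (simp add: power2_eq_square)
  also have "\<dots> = - ((b + 1) * A * ((c - 1 - (n - 1)) * (c - (n - 1)) * B) * w)"
    unfolding up down ..
  finally have 1: "n\<^sup>2 * ((b + 1) * legendre_term (b + 1) (Suc m)) = \<dots>" .
  have "n\<^sup>2 * (b * legendre_term (b - 1) (Suc m))
      = (n * (b * ((b - 1) gchoose Suc m))) * (n * ((c + 1) gchoose Suc m)) * w"
    unfolding legendre_term_def args w_def[symmetric] by (simp add: power2_eq_square)
  also have "\<dots> = (b - 1 - (n - 1)) * (b - (n - 1)) * A * ((c + 1) * B) * w"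
    unfolding up down ..
  finally have 2: "n\<^sup>2 * (b * legendre_term (b - 1) (Suc m)) = \<dots>" .
  have "n\<^sup>2 * legendre_term b (Suc m) = (n * (b gchoose Suc m)) * (n * (c gchoose Suc m)) * w"
    unfolding legendre_term_def c_def[symmetric] w_def[symmetric] by (simp add: power2_eq_square)
  also have "\<dots> = (b - (n - 1)) * A * ((c - (n - 1)) * B) * w"
    unfolding same ..
  finally have 3: "n\<^sup>2 * legendre_term b (Suc m) = \<dots>" .
  have 4: "legendre_term b m = A * B * (2 * w)"
    unfolding legendre_term_def A_def B_def w2 c_def ..
  have "n\<^sup>2 * ((b + 1) * legendre_term (b + 1) (Suc m) + b * legendre_term (b - 1) (Suc m))
      = (2 * b + 1) * (n\<^sup>2 * legendre_term b (Suc m) - n\<^sup>2 * legendre_term b m)"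
    unfolding distrib_left[of "n\<^sup>2"] 1 2 3 4 unfolding c_def
    by (simp add: algebra_simps power2_eq_square)
  also have "\<dots> = n\<^sup>2 * ((2 * b + 1) * (legendre_term b (Suc m) - legendre_term b m))"
    by (simp only: right_diff_distrib mult.left_commute)
  finally show ?thesis using n0 by simp
qed

lemma legendre_sum_recurrence:
  "(b + 1) * legendre_sum (b + 1) n + b * legendre_sum (b - 1) n = (2 * b + 1) * legendre_term b n"
proof (induction n)
  case 0
  show ?case by (simp add: legendre_sum_def legendre_term_def)
next
  case (Suc n)
  have step: "legendre_sum x (Suc n) = legendre_sum x n + legendre_term x (Suc n)" for x
    by (simp add: legendre_sum_def)
  show ?case using Suc legendre_term_telescope[of b n]
    unfolding step distrib_left[of _ "legendre_sum _ _"] right_diff_distrib by linarith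
qed

section \<open>The ring of p-integers and its congruences\<close>

context
  fixes p :: nat
  assumes p: "prime p"
begin

lemma of_int_pints: "of_int n \<in> pints p"
  unfolding mem_pints_iff[OF p] using p not_prime_1 by (intro exI[of _ n] exI[of _ 1]) auto

lemma of_nat_pints: "of_nat n \<in> pints p"
  using of_int_pints[of "int n"] by simp

lemma one_pints: "1 \<in> pints p"
  using of_int_pints[of 1] by simp

lemma inverse_of_nat_pints:
  assumes "\<not> p dvd n"
  shows "1 / of_nat n \<in> pints p"
  unfolding mem_pints_iff[OF p] using assms by (intro exI[of _ 1] exI[of _ "int n"]) auto

lemma mult_pints:
  assumes "x \<in> pints p" "y \<in> pints p"
  shows "x * y \<in> pints p"
proof -
  obtain a b c d where x: "\<not> int p dvd b" "x = of_int a / of_int b"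
    and y: "\<not> int p dvd d" "y = of_int c / of_int d"
    using assms unfolding mem_pints_iff[OF p] by blast
  have "\<not> int p dvd b * d" using x y p by (simp add: prime_dvd_mult_iff)
  then show ?thesis unfolding mem_pints_iff[OF p] x y
    by (intro exI[of _ "a * c"] exI[of _ "b * d"]) simp
qed

lemma add_pints:
  assumes "x \<in> pints p" "y \<in> pints p"
  shows "x + y \<in> pints p"
proof -
  obtain a b c d where x: "\<not> int p dvd b" "x = of_int a / of_int b"
    and y: "\<not> int p dvd d" "y = of_int c / of_int d"
    using assms unfolding mem_pints_iff[OF p] by blast
  have nd: "\<not> int p dvd b * d" using x y p by (simp add: prime_dvd_mult_iff)
  have "b \<noteq> 0" "d \<noteq> 0" using x y by auto
  then have "x + y = of_int (a * d + c * b) / of_int (b * d)" unfolding x y by (simp add: field_simps)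
  then show ?thesis using nd unfolding mem_pints_iff[OF p] by blast
qed

lemma uminus_pints: "x \<in> pints p \<Longrightarrow> - x \<in> pints p"
  using mult_pints[OF of_int_pints[of "-1"]] by simp

lemma diff_pints: "x \<in> pints p \<Longrightarrow> y \<in> pints p \<Longrightarrow> x - y \<in> pints p"
  using add_pints[of x "- y"] uminus_pints by simp

lemma pcongI:
  assumes "x \<in> pints p" "y \<in> pints p" "z \<in> pints p" "x - y = of_nat m * z"
  shows "pcong p x y m"
  using assms unfolding pcong_def by blast

lemma pcong_pints:
  assumes "pcong p x y m"
  shows "x \<in> pints p" "y \<in> pints p"
  using assms unfolding pcong_def by blast+

lemma pcong_refl: "x \<in> pints p \<Longrightarrow> pcong p x x m"
  by (rule pcongI[of _ _ 0]) (use of_int_pints[of 0] in auto)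

lemma pcong_trans:
  assumes "pcong p x y m" "pcong p y z m"
  shows "pcong p x z m"
proof -
  obtain u v where u: "u \<in> pints p" "x - y = of_nat m * u" and v: "v \<in> pints p" "y - z = of_nat m * v"
    using assms unfolding pcong_def by blast
  have "x - z = (x - y) + (y - z)" by simp
  also have "\<dots> = of_nat m * (u + v)" unfolding u v by (simp only: distrib_left)
  finally show ?thesis
    by (rule pcongI[OF pcong_pints(1)[OF assms(1)] pcong_pints(2)[OF assms(2)] add_pints[OF u(1) v(1)]])
qed

lemma pcong_add:
  assumes "pcong p x y m" "pcong p x' y' m"
  shows "pcong p (x + x') (y + y') m"
proof -
  obtain z z' where z: "z \<in> pints p" "x - y = of_nat m * z" "z' \<in> pints p" "x' - y' = of_nat m * z'"
    using assms unfolding pcong_def by blast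
  have "(x + x') - (y + y') = (x - y) + (x' - y')" by simp
  also have "\<dots> = of_nat m * (z + z')" unfolding z by (simp only: distrib_left)
  finally show ?thesis
    by (rule pcongI[rotated 3])
      (rule add_pints z assms[THEN pcong_pints(1)] assms[THEN pcong_pints(2)])+
qed

lemma pcong_mult:
  assumes "pcong p x y m" "pcong p x' y' m"
  shows "pcong p (x * x') (y * y') m"
proof -
  obtain z z' where z: "z \<in> pints p" "x - y = of_nat m * z" "z' \<in> pints p" "x' - y' = of_nat m * z'"
    using assms unfolding pcong_def by blast
  have "x * x' - y * y' = (x - y) * x' + y * (x' - y')" by (simp add: algebra_simps)
  also have "\<dots> = of_nat m * (z * x' + y * z')" unfolding z by (simp add: algebra_simps)
  finally show ?thesis
    by (rule pcongI[rotated 3])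
      (rule add_pints mult_pints z assms[THEN pcong_pints(1)] assms[THEN pcong_pints(2)])+
qed

lemma pcong_diff:
  assumes "pcong p x y m" "pcong p x' y' m"
  shows "pcong p (x - x') (y - y') m"
  using pcong_add[OF assms(1) pcong_mult[OF pcong_refl[OF of_int_pints[of "-1"]] assms(2)]] by simp

lemma pcong_sum:
  "(\<And>i. i \<in> A \<Longrightarrow> pcong p (f i) (g i) m) \<Longrightarrow> pcong p (\<Sum>i\<in>A. f i) (\<Sum>i\<in>A. g i) m"
  by (induction A rule: infinite_finite_induct)
    (use pcong_refl[OF of_int_pints[of 0]] in \<open>auto intro: pcong_add\<close>)

lemma pcong_prod:
  "(\<And>i. i \<in> A \<Longrightarrow> pcong p (f i) (g i) m) \<Longrightarrow> pcong p (\<Prod>i\<in>A. f i) (\<Prod>i\<in>A. g i) m"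
  by (induction A rule: infinite_finite_induct) (auto intro: pcong_mult pcong_refl one_pints)

lemma pcong_times_multiple:
  assumes "pcong p b 0 p" "pcong p x y p"
  shows "pcong p (b * x) (b * y) (p\<^sup>2)"
proof -
  obtain z z' where z: "z \<in> pints p" "b - 0 = of_nat p * z" "z' \<in> pints p" "x - y = of_nat p * z'"
    using assms unfolding pcong_def by blast
  have "b * x - b * y = (b - 0) * (x - y)" by (simp add: algebra_simps)
  also have "\<dots> = of_nat (p\<^sup>2) * (z * z')" unfolding z by (simp add: power2_eq_square)
  finally show ?thesis
    by (rule pcongI[rotated 3])
      (rule mult_pints z assms[THEN pcong_pints(1)] assms[THEN pcong_pints(2)])+
qed

lemma unit_if_pcong_nonzero:
  assumes u: "pcong p u (of_nat r) p" and r: "\<not> p dvd r"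
  shows "u \<noteq> 0" "inverse u \<in> pints p"
proof -
  obtain z where z: "z \<in> pints p" "u - of_nat r = of_nat p * z" and "u \<in> pints p"
    using u unfolding pcong_def by blast
  then obtain n d e f where nd: "\<not> int p dvd d" "u = of_int n / of_int d"
    and ef: "\<not> int p dvd f" "z = of_int e / of_int f"
    unfolding mem_pints_iff[OF p] by blast
  have d0: "d \<noteq> 0" "f \<noteq> 0" using nd ef by auto
  then have "(of_int (n * f - int r * (d * f)) :: rat) = of_int (int p * (e * d))"
    using z(2) unfolding nd ef by (simp add: field_simps)
  then have eq: "n * f - int r * (d * f) = int p * (e * d)" by (simp only: of_int_eq_iff)
  have n: "\<not> int p dvd n"
  proof
    assume "int p dvd n"
    then have "int p dvd n * f - int p * (e * d)" by simp
    also have "n * f - int p * (e * d) = int r * (d * f)" using eq by simp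
    finally show False using r nd ef p by (simp add: prime_dvd_mult_iff)
  qed
  then show "inverse u \<in> pints p" unfolding mem_pints_iff[OF p] nd
    by (intro exI[of _ d] exI[of _ n]) simp
  show "u \<noteq> 0" using n d0 unfolding nd by auto
qed

lemma pcong_zero_cancel_unit:
  assumes "pcong p (u * x) 0 m" "pcong p u (of_nat r) p" "\<not> p dvd r"
  shows "pcong p x 0 m"
proof -
  note u = unit_if_pcong_nonzero[OF assms(2,3)]
  have "pcong p (inverse u * (u * x)) (inverse u * 0) m"
    by (rule pcong_mult[OF pcong_refl[OF u(2)] assms(1)])
  then show ?thesis using u(1) by (simp add: mult.assoc[symmetric])
qed

lemma not_dvd_two:
  assumes "odd p"
  shows "\<not> p dvd 2"
  using assms p primes_dvd_imp_eq[of p 2] by auto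

lemma inverse_power_two_pints:
  assumes "odd p"
  shows "1 / 2 ^ k \<in> pints p"
proof -
  have "\<not> p dvd 2 ^ k" using not_dvd_two[OF assms] prime_dvd_power[OF p] by blast
  from inverse_of_nat_pints[OF this] show ?thesis by simp
qed

lemma pcong_gbinomial:
  assumes "pcong p x y p" "k < p"
  shows "pcong p (x gchoose k) (y gchoose k) p"
proof -
  have "\<not> p dvd fact k" using assms(2) p by (simp add: prime_dvd_fact_iff)
  from inverse_of_nat_pints[OF this] have f: "1 / fact k \<in> pints p" by simp
  have "pcong p ((\<Prod>i = 0..<k. x - of_nat i) * (1 / fact k))
      ((\<Prod>i = 0..<k. y - of_nat i) * (1 / fact k)) p"
    by (intro pcong_mult pcong_prod pcong_diff assms(1) pcong_refl of_nat_pints f)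
  then show ?thesis by (simp add: gbinomial_prod_rev)
qed

text \<open>Because \<open>x gchoose k\<close> modulo \<open>p\<close> depends only on \<open>x\<close> modulo \<open>p\<close>, it may be replaced by an
  ordinary binomial coefficient whose upper index is smaller than the lower one.\<close>

lemma gbinomial_pcong_zero:
  assumes "pcong p x (of_nat j) p" "j < k" "k < p"
  shows "pcong p (x gchoose k) 0 p"
  using pcong_gbinomial[OF assms(1,3)] assms(2)
  by (simp add: binomial_gbinomial[symmetric] binomial_eq_0)

lemma gbinomial_pints:
  assumes "x \<in> pints p" "k < p"
  shows "x gchoose k \<in> pints p"
  using pcong_gbinomial[OF pcong_refl[OF assms(1)] assms(2)] by (rule pcong_pints)

section \<open>The sum modulo the square of a prime\<close>

text \<open>Both \<open>b\<close> and \<open>-1 - b\<close> have residue below \<open>p - 1\<close>, so each of the two binomial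
  coefficients contributes one factor \<open>p\<close>.\<close>

lemma legendre_term_last_pcong_zero:
  assumes "odd p" "pcong p b (of_nat j) p" "0 < j" "j < p - 1"
  shows "pcong p (legendre_term b (p - 1)) 0 (p\<^sup>2)"
proof -
  have p1: "p - 1 < p" using prime_gt_0_nat[OF p] by simp
  have 1: "pcong p (b gchoose (p - 1)) 0 p" by (rule gbinomial_pcong_zero[OF assms(2,4) p1])
  have "pcong p (of_nat p - 1 - b) (of_nat p - 1 - of_nat j) p"
    by (intro pcong_diff pcong_refl of_nat_pints one_pints assms(2))
  moreover have "pcong p (- of_nat p) 0 p"
    using of_int_pints[of "- int p"] of_int_pints[of 0] of_int_pints[of "-1"]
    by (intro pcongI[of _ _ "-1"]) auto
  ultimately have "pcong p ((of_nat p - 1 - b) + - of_nat p) ((of_nat p - 1 - of_nat j) + 0) p"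
    by (rule pcong_add)
  then have "pcong p (-1 - b) (of_nat (p - 1 - j)) p"
    using assms(4) by (simp add: of_nat_diff diff_diff_eq)
  then have 2: "pcong p ((-1 - b) gchoose (p - 1)) 0 p"
    by (rule gbinomial_pcong_zero) (use assms(3,4) p1 in auto)
  have "pcong p ((b gchoose (p - 1)) * ((-1 - b) gchoose (p - 1)) * (1 / 2 ^ (p - 1)))
      ((b gchoose (p - 1)) * 0 * (1 / 2 ^ (p - 1))) (p\<^sup>2)"
    by (rule pcong_mult[OF pcong_times_multiple[OF 1 2] pcong_refl[OF inverse_power_two_pints]])
      (rule assms(1))
  then show ?thesis unfolding legendre_term_def by simp
qed

lemma gbinomial_minus_one: "(-1 :: rat) gchoose k = (-1) ^ k"
  using gbinomial_minus[of "1 :: rat" k] by (simp add: binomial_gbinomial[symmetric])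

lemma inverse_two_power_fermat:
  assumes "odd p"
  shows "pcong p (1 / 2 ^ (p - 1)) 1 p"
proof -
  have "[2 ^ (p - 1) = 1] (mod p)" by (rule fermat_theorem[OF p not_dvd_two[OF assms]])
  then have "p dvd 2 ^ (p - 1) - 1" by (rule cong_to_1_nat)
  then obtain t where t: "2 ^ (p - 1) - 1 = p * t" by (rule dvdE)
  have "(2 :: rat) ^ (p - 1) - 1 = of_nat (2 ^ (p - 1) - 1)" by (simp add: of_nat_diff)
  then have t': "(2 :: rat) ^ (p - 1) - 1 = of_nat p * of_nat t" unfolding t by simp
  have "1 / 2 ^ (p - 1) - (1 :: rat) = - (2 ^ (p - 1) - 1) * (1 / 2 ^ (p - 1))"
    by (simp add: field_simps)
  also have "\<dots> = of_nat p * (- (of_nat t * (1 / 2 ^ (p - 1))))" unfolding t' by simp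
  finally show ?thesis
    by (rule pcongI[rotated 3])
      (intro uminus_pints mult_pints of_nat_pints one_pints inverse_power_two_pints assms)+
qed

text \<open>Absorption extracts the factor \<open>b\<close> from \<open>b gchoose (p - 1)\<close>; the cofactor is needed only
  modulo \<open>p\<close>, where \<open>b = 0\<close>, \<open>2 ^ (p - 1) = 1\<close> and \<open>p - 1 = -1\<close>.\<close>

lemma legendre_term_last_pcong_self:
  assumes "odd p" "pcong p b 0 p"
  shows "pcong p (legendre_term b (p - 1)) b (p\<^sup>2)"
proof -
  define q where "q = 1 / (of_nat (p - 1) :: rat)"
  have "p \<noteq> 2" using assms(1) by auto
  then have p3: "p \<ge> 3" using prime_ge_2_nat[OF p] by simp
  have "\<not> p dvd p - 1" using p3 by (auto dest: dvd_imp_le)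
  from inverse_of_nat_pints[OF this] have qp: "q \<in> pints p" unfolding q_def .
  have q0: "(of_nat (p - 1) :: rat) \<noteq> 0" using p3 by simp
  have "(of_nat p :: rat) = of_nat (p - 1) + 1" using p3 by (simp add: of_nat_diff)
  then have "q - (-1) = of_nat p * q"
    using q0 unfolding q_def by (simp add: field_simps)
  then have q: "pcong p q (-1) p"
    by (rule pcongI[OF qp uminus_pints[OF one_pints] qp])
  have sp: "p - 1 = Suc (p - 2)" using p3 by simp
  have "of_nat (p - 1) * (b gchoose (p - 1)) = b * ((b - 1) gchoose (p - 2))"
    unfolding sp by (rule gbinomial_absorption)
  then have "b gchoose (p - 1) = b * (q * ((b - 1) gchoose (p - 2)))"
    unfolding q_def using q0 by (simp add: field_simps)
  then have t: "legendre_term b (p - 1)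
      = b * (q * ((b - 1) gchoose (p - 2)) * ((-1 - b) gchoose (p - 1)) * (1 / 2 ^ (p - 1)))"
    unfolding legendre_term_def by simp
  have "pcong p ((b - 1) gchoose (p - 2)) ((0 - 1) gchoose (p - 2)) p"
    by (intro pcong_gbinomial pcong_diff pcong_refl one_pints assms(2)) (use p3 in simp)
  moreover have "odd (p - 2)" using assms(1) p3 by simp
  ultimately have c1: "pcong p ((b - 1) gchoose (p - 2)) (-1) p"
    by (simp add: gbinomial_minus_one)
  have "pcong p ((-1 - b) gchoose (p - 1)) ((-1 - 0) gchoose (p - 1)) p"
    by (intro pcong_gbinomial pcong_diff pcong_refl uminus_pints one_pints assms(2)) (use p3 in simp)
  then have c2: "pcong p ((-1 - b) gchoose (p - 1)) 1 p"
    using assms(1) by (simp add: gbinomial_minus_one)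
  have "pcong p (q * ((b - 1) gchoose (p - 2)) * ((-1 - b) gchoose (p - 1)) * (1 / 2 ^ (p - 1)))
      ((-1) * (-1) * 1 * 1) p"
    by (intro pcong_mult q c1 c2 inverse_two_power_fermat assms(1))
  from pcong_times_multiple[OF assms(2) this] show ?thesis unfolding t by simp
qed

lemma legendre_sum_pcong_one:
  assumes "odd p" "pcong p b 0 p" "n < p"
  shows "pcong p (legendre_sum (b - 1) n) 1 p"
proof -
  have "pcong p (legendre_term (b - 1) k) (if k = 0 then 1 else 0) p" if k: "k \<in> {0..n}" for k
  proof (cases "k = 0")
    case True
    then show ?thesis by (simp add: legendre_term_def pcong_refl one_pints)
  next
    case False
    have kp: "k < p" using k assms(3) by simp
    have "pcong p (of_nat 0 - b) (of_nat 0 - 0) p"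
      by (intro pcong_diff pcong_refl of_nat_pints assms(2))
    then have "pcong p (- b) (of_nat 0) p" by simp
    then have "pcong p ((- b) gchoose k) 0 p"
      by (rule gbinomial_pcong_zero) (use False kp in auto)
    then have "pcong p (((b - 1) gchoose k) * ((- b) gchoose k) * (1 / 2 ^ k))
        (((b - 1) gchoose k) * 0 * (1 / 2 ^ k)) p"
      by (intro pcong_mult pcong_refl gbinomial_pints diff_pints one_pints inverse_power_two_pints
          assms(1) pcong_pints(1)[OF assms(2)] kp)
    then show ?thesis using False by (simp add: legendre_term_def)
  qed
  then have "pcong p (legendre_sum (b - 1) n) (\<Sum>k=0..n. if k = 0 then 1 else 0) p"
    unfolding legendre_sum_def by (rule pcong_sum)
  then show ?thesis by simp
qed

lemma legendre_sum_residue_one: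
  assumes "odd p" "pcong p a (of_nat 1) p"
  shows "pcong p (legendre_sum a (p - 1)) 0 (p\<^sup>2)"
proof -
  define b where "b = a - 1"
  have ab: "a = b + 1" unfolding b_def by simp
  have p1: "p - 1 < p" using prime_gt_0_nat[OF p] by simp
  have "pcong p (a - 1) (of_nat 1 - 1) p" by (intro pcong_diff assms(2) pcong_refl one_pints)
  then have b: "pcong p b 0 p" unfolding b_def by simp
  note bp = pcong_pints(1)[OF b]
  have coeff: "2 * b + 1 \<in> pints p"
    using add_pints[OF add_pints[OF bp bp] one_pints] by simp
  have rec: "a * legendre_sum a (p - 1)
      = (2 * b + 1) * legendre_term b (p - 1) - b * legendre_sum (b - 1) (p - 1)"
    using legendre_sum_recurrence[of b "p - 1"] unfolding ab by linarith
  have square: "(2 * b + 1) * b - b * 1 = b * (b + b)" by (simp add: algebra_simps)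
  have "pcong p ((2 * b + 1) * legendre_term b (p - 1)) ((2 * b + 1) * b) (p\<^sup>2)"
    by (intro pcong_mult pcong_refl coeff legendre_term_last_pcong_self assms(1) b)
  from pcong_diff[OF this pcong_times_multiple[OF b legendre_sum_pcong_one[OF assms(1) b p1]]]
  have "pcong p (a * legendre_sum a (p - 1)) (b * (b + b)) (p\<^sup>2)"
    unfolding rec square .
  moreover have "pcong p (b * (b + b)) (b * (0 + 0)) (p\<^sup>2)"
    by (intro pcong_times_multiple pcong_add b)
  ultimately have "pcong p (a * legendre_sum a (p - 1)) (b * (0 + 0)) (p\<^sup>2)"
    by (rule pcong_trans)
  then have "pcong p (a * legendre_sum a (p - 1)) 0 (p\<^sup>2)" by simp
  then show ?thesis
    by (rule pcong_zero_cancel_unit[OF _ assms(2)]) (use p not_prime_1 in auto)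
qed

lemma legendre_sum_odd_residue:
  assumes "odd p"
  shows "2 * j + 1 < p \<Longrightarrow> pcong p a (of_nat (2 * j + 1)) p
    \<Longrightarrow> pcong p (legendre_sum a (p - 1)) 0 (p\<^sup>2)"
proof (induction j arbitrary: a)
  case 0
  then show ?case using legendre_sum_residue_one[OF assms] by simp
next
  case (Suc j)
  define b where "b = a - 1"
  have ab: "a = b + 1" unfolding b_def by simp
  have "pcong p (a - 1) (of_nat (2 * Suc j + 1) - 1) p"
    by (intro pcong_diff Suc.prems pcong_refl one_pints)
  then have b: "pcong p b (of_nat (2 * Suc j)) p" unfolding b_def by simp
  note bp = pcong_pints(1)[OF b]
  have coeff: "2 * b + 1 \<in> pints p"
    using add_pints[OF add_pints[OF bp bp] one_pints] by simp
  have "pcong p (b - 1) (of_nat (2 * Suc j) - 1) p"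
    by (intro pcong_diff b pcong_refl one_pints)
  moreover have "(of_nat (2 * Suc j) - 1 :: rat) = of_nat (2 * j + 1)" by simp
  ultimately have "pcong p (b - 1) (of_nat (2 * j + 1)) p" by (simp only:)
  then have IH: "pcong p (legendre_sum (b - 1) (p - 1)) 0 (p\<^sup>2)"
    by (rule Suc.IH[rotated]) (use Suc.prems in simp)
  have T: "pcong p (legendre_term b (p - 1)) 0 (p\<^sup>2)"
    by (rule legendre_term_last_pcong_zero[OF assms b]) (use Suc.prems in auto)
  have rec: "a * legendre_sum a (p - 1)
      = (2 * b + 1) * legendre_term b (p - 1) - b * legendre_sum (b - 1) (p - 1)"
    using legendre_sum_recurrence[of b "p - 1"] unfolding ab by linarith
  have "pcong p ((2 * b + 1) * legendre_term b (p - 1) - b * legendre_sum (b - 1) (p - 1))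
      ((2 * b + 1) * 0 - b * 0) (p\<^sup>2)"
    by (intro pcong_diff pcong_mult pcong_refl coeff bp IH T)
  then have "pcong p (a * legendre_sum a (p - 1)) 0 (p\<^sup>2)"
    unfolding rec by simp
  then show ?case
    by (rule pcong_zero_cancel_unit[OF _ Suc.prems(2)]) (use Suc.prems(1) in \<open>auto dest: dvd_imp_le\<close>)
qed

end

theorem corollary2p3:
  fixes p :: nat and a :: rat
  assumes "prime p" and "odd p"
    and "a \<in> pints p"
    and "[least_residue p a = 1] (mod 2)"
  shows "pcong p (\<Sum>k=0..p-1. (a gchoose k) * ((-1 - a) gchoose k) * (1 / 2 ^ k)) 0 (p ^ 2)"
proof -
  have "odd (least_residue p a)"
    using assms(4) by (simp add: cong_def odd_iff_mod_2_eq_one)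
  then obtain j where j: "least_residue p a = 2 * j + 1" by (rule oddE)
  note r = least_residue[OF assms(1,3), unfolded j]
  from legendre_sum_odd_residue[OF assms(1,2) r] show ?thesis
    unfolding legendre_sum_def legendre_term_def .
qed

end
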